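(* Let $S\subset\mathbb{R}^3$ be a finite set of positive diameter such that the girth of its diameter graph satisfies $g(G_S)>3$. Then $a_k(S)<4k$ for some positive integer $k$.
   Context: For a set $S\subset\mathbb{R}^n$ of diameter $d>0$ and a positive integer $k$, the $k$-fold Borsuk number $a_k(S)$ is the smallest positive integer $m$ such that there is a $k$-fold cover of $S$ with $m$ sets of diameters strictly less than $d$. A $k$-fold cover of $S$ is a family of sets such that any point of $S$ belongs to at least $k$ members of the family; some members of the family are permitted to coincide (they are counted with multiplicity). The diameter graph $G_S$ of a finite set $S$ is the graph with vertex set $S$ in which two points are joined by an edge if and only if their distance equals the diameter of $S$. The girth $g(G)$ of a graph $G$ is the length of a shortest cycle of $G$ (infinite if $G$ has no cycle); thus $g(G_S)>3$ means that $G_S$ contains no triangle. *)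

theory Defs
  imports "HOL-Analysis.Analysis" "HOL-Library.Multiset" "HOL-Library.Extended_Nat"
begin

text \<open>A family of sets, some of which may coincide, is a multiset of sets.\<close>

definition kfold_cover :: "nat \<Rightarrow> 'a set \<Rightarrow> 'a set multiset \<Rightarrow> bool" where
  "kfold_cover k S F \<longleftrightarrow> (\<forall>x\<in>S. k \<le> size {#A \<in># F. x \<in> A#})"

text \<open>
  Boundedness is required because \<^const>\<open>diameter\<close> has an unspecified real
  value on unbounded sets; mathematically these have infinite diameter.
\<close>

definition smaller_diameter :: "'a::metric_space set \<Rightarrow> 'a set \<Rightarrow> bool" where
  "smaller_diameter A S \<longleftrightarrow> bounded A \<and> diameter A < diameter S"

text \<open>
  If \<open>S\<close> is a bounded subset of a Euclidean space with positive diameter, a suitable \<open>m\<close>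
  exists and the minimum is attained. Otherwise the value may be unspecified.
\<close>

definition borsuk_number :: "nat \<Rightarrow> 'a::metric_space set \<Rightarrow> nat" where
  "borsuk_number k S =
     (LEAST m. 0 < m \<and>
        (\<exists>F. size F = m \<and> kfold_cover k S F \<and> (\<forall>A\<in>#F. smaller_diameter A S)))"

text \<open>A simple graph is a pair of its vertex set and its set of two-element edges.\<close>

type_synonym 'a graph = "'a set \<times> 'a set set"

definition diameter_graph :: "'a::metric_space set \<Rightarrow> 'a graph" where
  "diameter_graph S =
     (S, {{x, y} | x y. x \<in> S \<and> y \<in> S \<and> x \<noteq> y \<and> dist x y = diameter S})"

text \<open>
  A cycle is given by the list of its distinct vertices in cyclic order, with the first
  vertex not repeated at the end; its length is therefore the length of the list.
\<close>

definition is_cycle :: "'a graph \<Rightarrow> 'a list \<Rightarrow> bool" where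
  "is_cycle G p \<longleftrightarrow> 3 \<le> length p \<and> distinct p \<and> set p \<subseteq> fst G \<and>
     (\<forall>i<length p. {p ! i, p ! (Suc i mod length p)} \<in> snd G)"

text \<open>The infimum of the empty set in \<^typ>\<open>enat\<close> is \<open>\<infinity>\<close>.\<close>

definition girth :: "'a graph \<Rightarrow> enat" where
  "girth G = (INF p\<in>{p. is_cycle G p}. enat (length p))"

end

theory Submission
  imports Defs
begin

text \<open>
  A subset of \<open>S\<close> has smaller diameter exactly if it is independent in the diameter graph
  \<open>G\<close>, so the claim says that the fractional chromatic number of \<open>G\<close> is less
  than \<open>4\<close>. It follows from one geometric and one combinatorial fact.

  Geometry (\<open>odd_closed_walks_of_diameters_meet\<close>): in \<open>\<real>\<^sup>3\<close> any two odd closed walks of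
  \<open>G\<close> share a vertex. The edge vectors of an odd closed walk, taken with alternating
  signs, form a polygonal path from some vector \<open>a\<close> to \<open>-a\<close>, which gives a nontrivial loop
  in the projective plane. Any two such loops meet (\<open>antipodal_polygons_meet\<close>): around each
  axis that misses the first path, that path sweeps out an odd multiple of \<open>\<pi>\<close>. This amount
  depends continuously on the axis, never vanishes, and changes sign when the axis is
  reversed, so a path from \<open>b\<close> to \<open>-b\<close> cannot consist of such axes only. On the other hand,
  each segment of the polygonal path lies, up to sign, in the cone that two diameters span at
  their common end, and for two vertex-disjoint walks no two of these cones have a line in
  common (\<open>diameter_cones_transversal\<close>).

  Combinatorics (\<open>fractional_cover_if_odd_closed_walks_meet\<close>): if \<open>G\<close> has no odd cycle, the two colour
  classes of a bipartition cover it. Otherwise let \<open>C\<close> be a shortest odd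
  cycle. As \<open>G\<close> has no triangle, \<open>C\<close> has length \<open>2m+1\<close> with \<open>m \<ge> 2\<close>. Without \<open>C\<close> no odd
  closed walk is left, so the other vertices split into two independent sets \<open>A\<close> and \<open>B\<close>. For
  each of the \<open>2m+1\<close> maximum independent sets \<open>J\<close> of \<open>C\<close> take \<open>J\<close> together with the vertices
  of \<open>A\<close> that have no neighbour in \<open>J\<close>, and the same with \<open>B\<close>; add \<open>m\<close> copies each of \<open>A\<close>
  and \<open>B\<close>. Since \<open>C\<close> is shortest, all neighbours on \<open>C\<close> of a vertex \<open>v\<close> are neighbours of a
  single vertex of \<open>C\<close>, so that at least \<open>m\<close> of the sets \<open>J\<close> avoid them. These \<open>6m+2\<close>
  independent sets therefore cover every vertex at least \<open>2m\<close> times, and \<open>6m+2 < 4 \<cdot> 2m\<close>.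
\<close>

section \<open>Closed walks and bipartite graphs\<close>

text \<open>
  Indexing a walk by all natural numbers, periodically, lets index arithmetic run past the
  end without reduction modulo \<open>n\<close>. Graphs are given by their symmetric adjacency relation.
\<close>

definition closed_walk :: "('a \<times> 'a) set \<Rightarrow> nat \<Rightarrow> (nat \<Rightarrow> 'a) \<Rightarrow> bool" where
  "closed_walk E n c \<longleftrightarrow> (\<forall>i. (c i, c (Suc i)) \<in> E) \<and> (\<forall>i. c (i + n) = c i)"

definition independent_in :: "('a \<times> 'a) set \<Rightarrow> 'a set \<Rightarrow> bool" where
  "independent_in E A \<longleftrightarrow> (\<forall>x\<in>A. \<forall>y\<in>A. (x, y) \<notin> E)"

lemma closed_walk_relpow: "closed_walk E n c \<Longrightarrow> (c i, c (i + j)) \<in> E ^^ j"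
  unfolding closed_walk_def relpow_fun_conv by (intro exI[of _ "\<lambda>k. c (i + k)"]) simp

lemma relpow_imp_closed_walk:
  assumes "(x, x) \<in> E ^^ n" "0 < n"
  obtains c where "closed_walk E n c" "c 0 = x"
proof -
  obtain f where f: "f 0 = x" "f n = x" "\<And>i. i < n \<Longrightarrow> (f i, f (Suc i)) \<in> E"
    using assms unfolding relpow_fun_conv by blast
  have "(f (i mod n), f (Suc i mod n)) \<in> E" for i
    using f(3)[of "i mod n"] f(1,2) \<open>0 < n\<close> by (auto simp: mod_Suc)
  then have "closed_walk E n (\<lambda>i. f (i mod n))"
    by (simp add: closed_walk_def)
  then show thesis
    using that f(1) by fastforce
qed

lemma relpow_sym:
  assumes "sym E" "(x, y) \<in> E ^^ n"
  shows "(y, x) \<in> E ^^ n"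
  using assms(2)
proof (induction n arbitrary: y)
  case (Suc n)
  then obtain z where z: "(x, z) \<in> E ^^ n" "(z, y) \<in> E"
    by auto
  with Suc.IH assms(1) have "(z, x) \<in> E ^^ n" "(y, z) \<in> E"
    by (auto dest: symD)
  then show ?case
    by (metis relpow_Suc_I2)
qed auto

text \<open>
  A vertex is coloured by the parity of the walks that lead to it from a root chosen in its
  component; walks of both parities would close up to an odd walk.
\<close>

lemma two_coloring_if_no_odd_closed_walk:
  assumes "sym E" and no_odd: "\<And>x n. odd n \<Longrightarrow> (x, x) \<notin> E ^^ n"
  obtains col :: "'a \<Rightarrow> bool" where "\<And>x y. (x, y) \<in> E \<Longrightarrow> col x \<noteq> col y"
proof -
  \<comment> \<open>Adjacent vertices reach the same set of vertices, so the choice operator gives them the same root.\<close>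
  define root where "root x = (SOME z. (x, z) \<in> E\<^sup>*)" for x
  define col where "col x \<longleftrightarrow> (\<exists>n. even n \<and> (root x, x) \<in> E ^^ n)" for x
  have "col x \<noteq> col y" if xy: "(x, y) \<in> E" for x y
  proof -
    have yx: "(y, x) \<in> E"
      using xy assms(1) by (auto dest: symD)
    have "(x, z) \<in> E\<^sup>* \<longleftrightarrow> (y, z) \<in> E\<^sup>*" for z
      using xy yx by (meson converse_rtrancl_into_rtrancl)
    then have root: "root y = root x"
      by (simp add: root_def)
    have "(x, root x) \<in> E\<^sup>*"
      unfolding root_def by (rule someI[of _ x]) simp
    then obtain n where n: "(root x, x) \<in> E ^^ n"
      using relpow_sym[OF assms(1)] rtrancl_imp_relpow by metis
    show ?thesis
    proof
      assume eq: "col x = col y"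
      show False
      proof (cases "col x")
        case True
        then obtain i j where ij: "even i" "(root x, x) \<in> E ^^ i" "even j" "(root x, y) \<in> E ^^ j"
          using eq root by (auto simp: col_def)
        then have "(x, y) \<in> E ^^ (i + j)"
          unfolding relpow_add using relpow_sym[OF assms(1)] by blast
        then have "(x, x) \<in> E ^^ Suc (i + j)"
          using yx by (rule relpow_Suc_I)
        moreover have "odd (Suc (i + j))"
          using ij by simp
        ultimately show False
          using no_odd by blast
      next
        case False
        then have "odd n"
          using n by (auto simp: col_def)
        then have "even (Suc n)"
          by simp
        moreover have "(root y, y) \<in> E ^^ Suc n"
          unfolding root using n xy by (rule relpow_Suc_I)
        ultimately have "col y"
          unfolding col_def by blast
        then show False
          using False eq by simp
      qed
    qed
  qed
  then show thesis
    using that by blast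
qed

section \<open>Shortest odd closed walks\<close>

locale shortest_odd_closed_walk =
  fixes E :: "('a \<times> 'a) set" and c :: "nat \<Rightarrow> 'a" and L :: nat
  assumes sym: "sym E"
    and walk: "closed_walk E L c"
    and odd: "odd L"
    and shortest: "\<And>x n. odd n \<Longrightarrow> (x, x) \<in> E ^^ n \<Longrightarrow> L \<le> n"
    and five: "5 \<le> L"
begin

lemma periodic: "c (i + L) = c i" and edge: "(c i, c (Suc i)) \<in> E"
  using walk by (auto simp: closed_walk_def)

lemma periodic_mod: "c (i mod L) = c i"
proof -
  have "c (j + k * L) = c j" for j k
  proof (induction k)
    case (Suc k)
    have "j + Suc k * L = j + k * L + L"
      by simp
    with Suc show ?case
      by (simp only: periodic)
  qed simp
  from this[of "i mod L" "i div L"] show ?thesis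
    by simp
qed

text \<open>
  The detour of length \<open>t\<close> closes up with one of the two arcs of the walk between the same
  end points, of lengths \<open>j\<close> and \<open>L - j\<close>, to an odd closed walk, since \<open>L\<close> is odd. Taking
  \<open>t = 1\<close> and \<open>t = 2\<close> restricts chords and common neighbours.
\<close>

lemma no_shortcut:
  assumes "(c i, c (i + j)) \<in> E ^^ t" "j \<le> L"
  shows "odd (t + j) \<and> L \<le> t + j \<or> even (t + j) \<and> j \<le> t"
proof (cases "odd (t + j)")
  case True
  have "(c i, c i) \<in> E ^^ (j + t)"
    unfolding relpow_add
    using closed_walk_relpow[OF walk] relpow_sym[OF sym assms(1)] by blast
  with True shortest show ?thesis
    by (auto simp: add.commute)
next
  case False
  have "(c (i + j), c (i + j + (L - j))) \<in> E ^^ (L - j)"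
    by (rule closed_walk_relpow[OF walk])
  then have "(c (i + j), c i) \<in> E ^^ (L - j)"
    using \<open>j \<le> L\<close> periodic by simp
  then have "(c i, c i) \<in> E ^^ (t + (L - j))"
    unfolding relpow_add using assms(1) by blast
  moreover have "odd (t + (L - j))"
    using False odd \<open>j \<le> L\<close> by auto
  ultimately have "L \<le> t + (L - j)"
    using shortest by blast
  with False \<open>j \<le> L\<close> show ?thesis
    by auto
qed

text \<open>
  The maximum independent sets of the cycle: every second vertex, leaving out the two
  consecutive vertices with indices \<open>g + L - 1\<close> and \<open>g + L\<close>.
\<close>

definition alternate :: "nat \<Rightarrow> 'a set" where
  "alternate g = (\<lambda>s. c (g + 2 * s + 1)) ` {..<L div 2}"

lemma independent_alternate: "independent_in E (alternate g)"
proof -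
  have no: "(c i, c (i + 2 * d)) \<notin> E" if "2 * d + 3 \<le> L" for i d
  proof
    assume "(c i, c (i + 2 * d)) \<in> E"
    with no_shortcut[of i "2 * d" 1] that show False
      by auto
  qed
  have "(c (g + 2 * s + 1), c (g + 2 * s' + 1)) \<notin> E"
    if "s < L div 2" "s' < L div 2" "s \<le> s'" for s s'
  proof -
    have "2 * (s' - s) + 3 \<le> L" "g + 2 * s + 1 + 2 * (s' - s) = g + 2 * s' + 1"
      using that odd by (auto elim!: oddE)
    then show ?thesis
      using no[of "s' - s" "g + 2 * s + 1"] by metis
  qed
  then have "(c (g + 2 * s + 1), c (g + 2 * s' + 1)) \<notin> E"
    if "s < L div 2" "s' < L div 2" for s s'
    using that sym by (metis linear symD)
  then show ?thesis
    by (auto simp: independent_in_def alternate_def)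
qed

text \<open>
  For each offset \<open>2 * s + 1\<close> there is one start \<open>g\<close> that puts \<open>c r\<close> at this offset, and
  different offsets need different starts as they differ by less than \<open>L\<close>.
\<close>

lemma card_alternate_ge: "L div 2 \<le> card {g. g < L \<and> c r \<in> alternate g}"
proof -
  \<comment> \<open>This is \<open>r - (2 * s + 1)\<close> modulo \<open>L\<close>; the summand \<open>2 * L\<close> keeps the subtraction from truncating.\<close>
  define f where "f s = (r + (2 * L - 2 * s - 1)) mod L" for s
  have "inj_on f {..<L div 2}"
  proof (rule inj_onI)
    fix s s' assume s: "s \<in> {..<L div 2}" "s' \<in> {..<L div 2}" and eq: "f s = f s'"
    have *: "s = s'" if "s \<le> s'" "s' < L div 2" "f s = f s'" for s s'
    proof -
      have "L dvd (r + (2 * L - 2 * s - 1)) - (r + (2 * L - 2 * s' - 1))"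
        using that(3) by (intro mod_eq_dvd_iff_nat[THEN iffD1]) (use that in \<open>auto simp: f_def\<close>)
      then have "L dvd 2 * (s' - s)"
        using that by (simp add: algebra_simps) 
      then show "s = s'"
        using that by (auto dest!: dvd_imp_le)
    qed
    show "s = s'"
      using *[of s s'] *[of s' s] s eq by (metis lessThan_iff linear)
  qed
  then have "L div 2 = card (f ` {..<L div 2})"
    by (simp add: card_image)
  also have "f ` {..<L div 2} \<subseteq> {g. g < L \<and> c r \<in> alternate g}"
  proof safe
    fix s assume s: "s < L div 2"
    then show "f s < L"
      using five by (simp add: f_def)
    have "(f s + (2 * s + 1)) mod L = (r + (2 * L - 2 * s - 1) + (2 * s + 1)) mod L"
      unfolding f_def by (rule mod_add_left_eq)
    also have "r + (2 * L - 2 * s - 1) + (2 * s + 1) = r + L + L"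
      using s by auto
    finally have "c (f s + (2 * s + 1)) = c (r + L + L)"
      using periodic_mod by metis
    then have "c r = c (f s + 2 * s + 1)"
      by (simp add: periodic flip: add.assoc)
    then show "c r \<in> alternate (f s)"
      using s unfolding alternate_def by blast
  qed
  then have "card (f ` {..<L div 2}) \<le> card {g. g < L \<and> c r \<in> alternate g}"
    by (intro card_mono) auto
  finally show ?thesis .
qed

text \<open>
  Two neighbours of \<open>v\<close> on the cycle are joined by a walk of length 2 through \<open>v\<close>, hence
  coincide or are two steps apart. Three of them would make a cycle of length 6, which is
  even; so there are at most two, and \<open>c r\<close> is the vertex between them.
\<close>

lemma neighbours_on_walk:
  obtains r where "\<And>i. (v, c i) \<in> E \<Longrightarrow> (c r, c i) \<in> E"
proof (cases "\<exists>i. (v, c i) \<in> E")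
  case False
  with that show ?thesis by blast
next
  case True
  have gap: "j \<in> {0, 2, L - 2}" if "(v, c i) \<in> E" "(v, c (i + j)) \<in> E" "j < L" for i j
  proof -
    have "(c i, c (i + j)) \<in> E ^^ 2"
      using that sym by (auto simp: numeral_2_eq_2 dest: symD)
    with no_shortcut[of i j 2] that odd show ?thesis
      by (auto elim!: oddE evenE)
  qed
  \<comment> \<open>\<open>L * i - i\<close> stands for \<open>- i\<close> modulo \<open>L\<close>.\<close>
  have rel: "\<exists>j<L. c k = c (i + j)" for i k
  proof -
    define j where "j = (k + (L * i - i)) mod L"
    have "(i + j) mod L = (i + (k + (L * i - i))) mod L"
      unfolding j_def by (rule mod_add_right_eq)
    also have "i + (k + (L * i - i)) = k + L * i"
      using five by (cases L) auto
    finally have "c k = c (i + j)"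
      using periodic_mod by (metis mod_mult_self2)
    moreover have "j < L"
      using five by (simp add: j_def)
    ultimately show ?thesis by blast
  qed
  \<comment> \<open>Start from any neighbour; if the vertex two steps before it is a neighbour too, start there.\<close>
  have "\<exists>q. \<forall>k. (v, c k) \<in> E \<longrightarrow> c k = c q \<or> c k = c (q + 2)"
  proof -
    obtain q where q: "(v, c q) \<in> E"
      using True by blast
    show ?thesis
    proof (cases "(v, c (q + (L - 2))) \<in> E")
      case True
      let ?q = "q + (L - 2)"
      have q2: "c (?q + 2) = c q"
      proof -
        have "?q + 2 = q + L"
          using five by simp
        then show ?thesis
          using periodic by metis
      qed
      have "c k = c ?q \<or> c k = c (?q + 2)" if k: "(v, c k) \<in> E" for k
      proof -
        obtain j where j: "j < L" "c k = c (q + j)"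
          using rel by blast
        then have "j \<in> {0, 2, L - 2}"
          using gap[OF q] k by simp
        moreover have "j \<noteq> 2"
        proof
          assume "j = 2"
          then have "c k = c (?q + 4)"
          proof -
            have "?q + 4 = q + 2 + L"
              using five by simp
            then show ?thesis
              using periodic j \<open>j = 2\<close> by metis
          qed
          then have "4 \<in> {0, 2, L - 2}"
            using gap[OF True, of 4] k five by simp
          then have "L = 6"
            using five by auto
          then show False
            using odd by simp
        qed
        ultimately show ?thesis
          using j q2 by auto
      qed
      then show ?thesis by blast
    next
      case False
      have "c k = c q \<or> c k = c (q + 2)" if k: "(v, c k) \<in> E" for k
      proof -
        obtain j where j: "j < L" "c k = c (q + j)"
          using rel by blast
        then have "j \<in> {0, 2, L - 2}"
          using gap[OF q] k by simp
        then show ?thesis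
          using j False k by auto
      qed
      then show ?thesis by blast
    qed
  qed
  then obtain q where q: "\<And>k. (v, c k) \<in> E \<Longrightarrow> c k = c q \<or> c k = c (q + 2)"
    by blast
  have "(c (Suc q), c q) \<in> E" "(c (Suc q), c (q + 2)) \<in> E"
    using edge[of q] edge[of "Suc q"] sym by (auto dest: symD)
  then show ?thesis
    using that q by metis
qed

text \<open>
  An independent set that contains the vertex \<open>c r\<close> of the preceding lemma avoids every
  neighbour of \<open>v\<close>, because on the walk these are all neighbours of \<open>c r\<close>.
\<close>

lemma card_alternate_avoiding_ge:
  "L div 2 \<le> card {g. g < L \<and> (\<forall>u\<in>alternate g. (v, u) \<notin> E)}"
proof -
  obtain r where r: "\<And>i. (v, c i) \<in> E \<Longrightarrow> (c r, c i) \<in> E"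
    using neighbours_on_walk by blast
  have "{g. g < L \<and> c r \<in> alternate g} \<subseteq> {g. g < L \<and> (\<forall>u\<in>alternate g. (v, u) \<notin> E)}"
    using r independent_alternate unfolding independent_in_def
    by (auto simp: alternate_def) blast
  then have "card {g. g < L \<and> c r \<in> alternate g}
      \<le> card {g. g < L \<and> (\<forall>u\<in>alternate g. (v, u) \<notin> E)}"
    by (intro card_mono) auto
  with card_alternate_ge[of r] show ?thesis
    by linarith
qed

end

section \<open>Covering a graph whose odd closed walks meet\<close>

lemma size_filter_image_mset_lessThan:
  fixes n :: nat
  shows "size {#A \<in># image_mset f (mset_set {..<n}). P A#} = card {g. g < n \<and> P (f g)}"
  by (subst filter_mset_image_mset) simp

lemma size_filter_replicate_mset:
  "size {#A \<in># replicate_mset n B. P A#} = (if P B then n else 0)"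
  by (induction n) auto

text \<open>
  The numbers balance as follows, where \<open>L = 2 * m + 1\<close>. A vertex of the shortest odd closed
  walk lies in \<open>m\<close> of the alternating sets, each of which is used once with either colour class.
  Any other vertex lies in the \<open>m\<close> copies of its colour class and in at least \<open>m\<close> mixed sets.
  This is \<open>2 * m\<close> in both cases, and \<open>2 * L + 2 * m < 8 * m\<close> holds because \<open>L \<ge> 5\<close>.
\<close>

theorem fractional_cover_if_odd_closed_walks_meet:
  fixes E :: "('a \<times> 'a) set"
  assumes "sym E"
    and no_loop: "\<And>x. (x, x) \<notin> E"
    and no_triangle: "\<And>x. (x, x) \<notin> E ^^ 3"
    and meet: "\<And>n m c d. \<lbrakk>odd n; odd m; closed_walk E n c; closed_walk E m d\<rbrakk>
                 \<Longrightarrow> range c \<inter> range d \<noteq> {}"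
  obtains k F where "0 < k" "size F < 4 * k" "\<And>x. k \<le> size {#A \<in># F. x \<in> A#}"
    "\<And>A. A \<in># F \<Longrightarrow> independent_in E A"
proof (cases "\<exists>n x. odd n \<and> (x, x) \<in> E ^^ n")
  case False
  then obtain col :: "'a \<Rightarrow> bool" where col: "\<And>x y. (x, y) \<in> E \<Longrightarrow> col x \<noteq> col y"
    using two_coloring_if_no_odd_closed_walk[OF assms(1)] by metis
  show thesis
    by (rule that[of 1 "{#{x. col x}, {x. \<not> col x}#}"])
      (use col in \<open>auto simp: independent_in_def\<close>)
next
  case True
  define L where "L = (LEAST n. odd n \<and> (\<exists>x. (x, x) \<in> E ^^ n))"
  have "odd L \<and> (\<exists>x. (x, x) \<in> E ^^ L)"
    unfolding L_def by (rule LeastI_ex) (use True in blast)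
  then obtain x where L: "odd L" "(x, x) \<in> E ^^ L"
    by blast
  have shortest: "L \<le> n" if "odd n" "(y, y) \<in> E ^^ n" for n y
    unfolding L_def using that by (intro Least_le) blast
  obtain c where c: "closed_walk E L c"
    using relpow_imp_closed_walk L odd_pos by metis
  have "L \<noteq> 1" "L \<noteq> 3"
    using L no_loop no_triangle by auto
  with \<open>odd L\<close> have "5 \<le> L"
    by (auto elim!: oddE)
  then interpret shortest_odd_closed_walk E c L
    using assms(1) c L shortest by unfold_locales auto
  define C where "C = range c"
  define E' where "E' = E \<inter> (- C) \<times> (- C)"
  have "sym E'"
    using assms(1) by (auto simp: E'_def sym_def)
  moreover have "(y, y) \<notin> E' ^^ n" if "odd n" for y n
  proof
    assume "(y, y) \<in> E' ^^ n"
    then obtain d where d: "closed_walk E' n d"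
      using relpow_imp_closed_walk \<open>odd n\<close> odd_pos by metis
    then have "closed_walk E n d" "range d \<subseteq> - C"
      by (auto simp: closed_walk_def E'_def)
    with meet[OF L(1) \<open>odd n\<close> c] show False
      by (auto simp: C_def)
  qed
  ultimately obtain col :: "'a \<Rightarrow> bool" where col: "\<And>x y. (x, y) \<in> E' \<Longrightarrow> col x \<noteq> col y"
    using two_coloring_if_no_odd_closed_walk by metis
  define A where "A b = {x. x \<notin> C \<and> col x = b}" for b
  define J where "J b g = alternate g \<union> {x \<in> A b. \<forall>u\<in>alternate g. (x, u) \<notin> E}" for b g
  define m where "m = L div 2"
  define F where "F = image_mset (J True) (mset_set {..<L}) + image_mset (J False) (mset_set {..<L})
     + (replicate_mset m (A True) + replicate_mset m (A False))"
  have L_eq: "L = 2 * m + 1" and m: "2 \<le> m"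
    using \<open>odd L\<close> \<open>5 \<le> L\<close> by (auto simp: m_def elim!: oddE)
  have indep_A: "independent_in E (A b)" for b
    using col by (auto simp: independent_in_def A_def E'_def)
  have indep_J: "independent_in E (J b g)" for b g
    using indep_A[of b] independent_alternate[of g] symD[OF assms(1)]
    unfolding independent_in_def J_def by blast
  have count: "size {#B \<in># F. x \<in> B#} = card {g. g < L \<and> x \<in> J True g} + card {g. g < L \<and> x \<in> J False g}
     + ((if x \<in> A True then m else 0) + (if x \<in> A False then m else 0))" for x
    by (simp add: F_def size_filter_image_mset_lessThan size_filter_replicate_mset)
  have "2 * m \<le> size {#B \<in># F. x \<in> B#}" for x
  proof (cases "x \<in> C")
    case True
    then obtain r where x: "x = c r"
      by (auto simp: C_def)
    have "m \<le> card {g. g < L \<and> x \<in> J b g}" for b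
      unfolding m_def x by (rule order_trans[OF card_alternate_ge[of r] card_mono]) (auto simp: J_def)
    from this[of True] this[of False] show ?thesis
      unfolding count by linarith
  next
    case False
    then have x: "x \<in> A (col x)"
      by (simp add: A_def)
    have "m \<le> card {g. g < L \<and> x \<in> J (col x) g}"
      unfolding m_def
      by (rule order_trans[OF card_alternate_avoiding_ge[of x] card_mono]) (use x in \<open>auto simp: J_def\<close>)
    then show ?thesis
      using x unfolding count by (cases "col x") auto
  qed
  moreover have "size F < 4 * (2 * m)"
    using m by (simp add: F_def L_eq)
  moreover have "independent_in E B" if "B \<in># F" for B
    using that indep_A indep_J by (auto simp: F_def split: if_splits)
  ultimately show thesis
    using m by (intro that[of "2 * m" F]) auto
qed

section \<open>Antipodal polygonal paths in space meet projectively\<close>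

unbundle cross3_syntax

text \<open>
  Up to the positive factor \<open>(norm z)\<^sup>2\<close>, this is the product of the projection of \<open>b\<close> to
  the plane orthogonal to \<open>z\<close> with the conjugate of the projection of \<open>a\<close>, when that plane is
  identified with the complex numbers in the orientation given by \<open>z\<close>. Its argument is the
  angle by which one turns from \<open>a\<close> to \<open>b\<close> around the axis \<open>z\<close>.
\<close>

definition turn :: "real^3 \<Rightarrow> real^3 \<Rightarrow> real^3 \<Rightarrow> complex" where
  "turn z a b = Complex ((z \<times> a) \<bullet> (z \<times> b)) (norm z * (z \<bullet> (a \<times> b)))"

text \<open>Additivity of the angle of rotation, written multiplicatively.\<close>

lemma turn_mult:
  "turn z a b * turn z b c = of_real ((norm (z \<times> b))\<^sup>2) * turn z a c"
proof -
  have n: "norm z * norm z = z $ 1 * z $ 1 + z $ 2 * z $ 2 + z $ 3 * z $ 3"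
    using dot_square_norm[of z] by (simp add: inner_vec_def sum_3 power2_eq_square)
  have b: "(norm (z \<times> b))\<^sup>2 = (z \<times> b) \<bullet> (z \<times> b)"
    by (simp add: dot_square_norm)
  have re: "((z \<times> a) \<bullet> (z \<times> b)) * ((z \<times> b) \<bullet> (z \<times> c))
      - (norm z * norm z) * ((z \<bullet> (a \<times> b)) * (z \<bullet> (b \<times> c)))
      = ((z \<times> b) \<bullet> (z \<times> b)) * ((z \<times> a) \<bullet> (z \<times> c))"
    unfolding n by (simp add: cross3_def inner_vec_def sum_3) algebra
  have im: "((z \<times> a) \<bullet> (z \<times> b)) * (z \<bullet> (b \<times> c)) + (z \<bullet> (a \<times> b)) * ((z \<times> b) \<bullet> (z \<times> c))
      = ((z \<times> b) \<bullet> (z \<times> b)) * (z \<bullet> (a \<times> c))"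
    by (simp add: cross3_def inner_vec_def sum_3) algebra
  show ?thesis
    unfolding turn_def b complex_eq_iff
    using re arg_cong[OF im, of "\<lambda>t. norm z * t"] by (simp add: algebra_simps)
qed

lemma turn_self: "turn z a a = of_real ((norm (z \<times> a))\<^sup>2)"
  by (simp add: turn_def complex_eq_iff dot_square_norm)

lemma turn_minus_right: "turn z a (- b) = - turn z a b"
  by (simp add: turn_def complex_eq_iff)

lemma turn_minus_axis: "turn (- z) a b = cnj (turn z a b)"
  by (simp add: turn_def complex_eq_iff)

text \<open>
  An angle of \<open>\<pi>\<close> means that the projections of \<open>a\<close> and \<open>b\<close> along \<open>z\<close> point in opposite
  directions, so that the projection of the segment passes through the origin.
\<close>

lemma turn_nonpos_imp_parallel:
  assumes "turn z a b \<in> \<real>\<^sub>\<le>\<^sub>0"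
  shows "\<exists>s\<in>closed_segment a b. z \<times> s = 0"
proof (cases "z \<times> a = 0")
  case True
  then show ?thesis by auto
next
  case False
  then have "z \<noteq> 0" by auto
  with assms have det: "z \<bullet> (a \<times> b) = 0" and le: "(z \<times> a) \<bullet> (z \<times> b) \<le> 0"
    by (auto simp: turn_def complex_nonpos_Reals_iff)
  have "(z \<times> a) \<times> (z \<times> b) = (z \<bullet> (a \<times> b)) *\<^sub>R z"
    by (simp add: cross3_simps exhaust_3 forall_3)
  with det False obtain k where k: "z \<times> b = k *\<^sub>R (z \<times> a)"
    unfolding cross_eq_0 
    by (metis collinear_lemma cross_eq_0 scaleR_zero_left)
  with le False have "k \<le> 0"
    by (simp add: mult_le_0_iff) (metis inner_gt_zero_iff linorder_not_le)
  \<comment> \<open>The point where the projected segment from \<open>z \<times> a\<close> to \<open>k *\<^sub>R (z \<times> a)\<close> vanishes.\<close>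
  define u where "u = 1 / (1 - k)"
  have u: "0 \<le> u" "u \<le> 1" "1 - u + u * k = 0"
    using \<open>k \<le> 0\<close> by (auto simp: u_def field_simps)
  have "z \<times> ((1 - u) *\<^sub>R a + u *\<^sub>R b) = (1 - u + u * k) *\<^sub>R (z \<times> a)"
    by (simp add: cross_add_right cross_mult_right k scaleR_add_left)
  then have "z \<times> ((1 - u) *\<^sub>R a + u *\<^sub>R b) = 0"
    using u by simp
  then show ?thesis
    using u unfolding closed_segment_def by blast
qed

text \<open>
  The total angle swept by the path around the axis \<open>z\<close>. Adding up principal values is
  appropriate as long as the axis misses the path: then no single step turns by \<open>\<pi>\<close>.
\<close>

definition sweep :: "(nat \<Rightarrow> real^3) \<Rightarrow> nat \<Rightarrow> real^3 \<Rightarrow> real" where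
  "sweep a n z = (\<Sum>i<n. Arg (turn z (a i) (a (Suc i))))"

lemma cis_sweep:
  assumes "\<And>i. i \<le> n \<Longrightarrow> z \<times> a i \<noteq> 0"
    and "\<And>i. i < n \<Longrightarrow> turn z (a i) (a (Suc i)) \<notin> \<real>\<^sub>\<le>\<^sub>0"
  shows "cis (sweep a n z) = sgn (turn z (a 0) (a n))"
  using assms
proof (induction n)
  case 0
  then show ?case
    using 0(1)[of 0] by (simp add: sweep_def turn_self sgn_of_real flip: of_real_power)
next
  case (Suc n)
  have nz: "turn z (a n) (a (Suc n)) \<noteq> 0"
    using Suc.prems(2)[of n] by auto
  have "cis (sweep a (Suc n) z) = sgn (turn z (a 0) (a n)) * sgn (turn z (a n) (a (Suc n)))"
    using Suc nz by (simp add: sweep_def cis_Arg flip: cis_mult)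
  also have "\<dots> = sgn (of_real ((norm (z \<times> a n))\<^sup>2)) * sgn (turn z (a 0) (a (Suc n)))"
    by (simp only: turn_mult flip: sgn_mult)
  also have "sgn (of_real ((norm (z \<times> a n))\<^sup>2)) = (1::complex)"
    using Suc.prems(1)[of n] by (simp add: sgn_of_real flip: of_real_power)
  finally show ?case by simp
qed

text \<open>
  From a vector to its opposite, the swept angle is an odd multiple of \<open>\<pi>\<close>.
\<close>

lemma sweep_neq_0:
  assumes "\<And>i. i \<le> n \<Longrightarrow> z \<times> a i \<noteq> 0"
    and "\<And>i. i < n \<Longrightarrow> turn z (a i) (a (Suc i)) \<notin> \<real>\<^sub>\<le>\<^sub>0"
    and "a n = - a 0"
  shows "sweep a n z \<noteq> 0"
proof
  assume "sweep a n z = 0"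
  then have "1 = sgn (turn z (a 0) (- a 0))"
    using cis_sweep[of n z a] assms by simp
  also have "\<dots> = - sgn (of_real ((norm (z \<times> a 0))\<^sup>2))"
    by (simp only: turn_minus_right turn_self sgn_minus)
  also have "\<dots> = - 1"
    using assms(1)[of 0] by (simp add: sgn_of_real flip: of_real_power)
  finally show False by simp
qed

text \<open>
  Reversing the axis reverses the orientation of the orthogonal plane. The hypothesis
  excludes the angle \<open>\<pi>\<close>, whose principal value would not change sign.
\<close>

lemma sweep_minus_axis:
  assumes "\<And>i. i < n \<Longrightarrow> turn z (a i) (a (Suc i)) \<notin> \<real>\<^sub>\<le>\<^sub>0"
  shows "sweep a n (- z) = - sweep a n z"
proof -
  have "Arg (cnj w) = - Arg w" if "w \<notin> \<real>\<^sub>\<le>\<^sub>0" for w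
    using that by (auto simp: Arg_cnj complex_is_Real_iff complex_nonpos_Reals_iff Arg_eq_0)
  with assms show ?thesis
    by (simp add: sweep_def turn_minus_axis sum_negf)
qed

lemma continuous_on_sweep:
  assumes "\<And>z i. z \<in> B \<Longrightarrow> i < n \<Longrightarrow> turn z (a i) (a (Suc i)) \<notin> \<real>\<^sub>\<le>\<^sub>0"
  shows "continuous_on B (sweep a n)"
proof -
  have "continuous_on B (\<lambda>z. turn z (a i) (a (Suc i)))" for i
    unfolding turn_def Complex_eq
    by (intro continuous_intros continuous_on_cross)
  then show ?thesis
    unfolding sweep_def by (intro continuous_intros) (use assms in auto)
qed

text \<open>
  If the paths did not meet, the angle swept by \<open>a\<close> around the points of the path \<open>b\<close> would be
  continuous and nonzero, hence of constant sign along \<open>b\<close>; but it takes opposite values at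
  the two ends of \<open>b\<close>.
\<close>

theorem antipodal_polygons_meet:
  fixes a b :: "nat \<Rightarrow> real^3"
  assumes "0 < n" "a n = - a 0" and "0 < m" "b m = - b 0"
  shows "\<exists>i<n. \<exists>j<m. \<exists>s\<in>closed_segment (a i) (a (Suc i)).
           \<exists>t\<in>closed_segment (b j) (b (Suc j)). t \<times> s = 0"
proof (rule ccontr)
  assume contra: "\<not> ?thesis"
  define B where "B = (\<Union>j<m. closed_segment (b j) (b (Suc j)))"
  have *: "z \<times> s \<noteq> 0" if "z \<in> B" "i < n" "s \<in> closed_segment (a i) (a (Suc i))" for z i s
    using that contra unfolding B_def by auto
  have turn: "turn z (a i) (a (Suc i)) \<notin> \<real>\<^sub>\<le>\<^sub>0" if "z \<in> B" "i < n" for z i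
    using that * turn_nonpos_imp_parallel by blast
  have cross: "z \<times> a i \<noteq> 0" if "z \<in> B" "i \<le> n" for z i
    using *[OF \<open>z \<in> B\<close>, of i "a i"] *[OF \<open>z \<in> B\<close>, of "i - 1" "a i"] that \<open>0 < n\<close>
    by (cases "i < n") auto
  have nz: "sweep a n z \<noteq> 0" if "z \<in> B" for z
    using that assms(2) cross turn by (intro sweep_neq_0) auto
  have "sgn (sweep a n (b j)) = sgn (sweep a n (b 0))" if "j \<le> m" for j
    using that
  proof (induction j)
    case (Suc j)
    let ?I = "closed_segment (b j) (b (Suc j))"
    have sub: "?I \<subseteq> B"
      using Suc.prems unfolding B_def by (intro UN_upper) auto
    then have "connected (sweep a n ` ?I)"
      by (intro connected_continuous_image continuous_on_sweep) (use turn in auto)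
    moreover have "0 \<notin> sweep a n ` ?I"
      using nz sub by auto
    ultimately have "sgn x = sgn y" if "x \<in> sweep a n ` ?I" "y \<in> sweep a n ` ?I" for x y
      using that connectedD_interval[of "sweep a n ` ?I" x y 0]
        connectedD_interval[of "sweep a n ` ?I" y x 0]
      by (metis linorder_not_le order_less_imp_le sgn_neg sgn_pos)
    then show ?case
      using Suc by (simp add: image_iff) (metis ends_in_segment)
  qed auto
  moreover have "b 0 \<in> B"
    using \<open>0 < m\<close> by (auto simp: B_def)
  ultimately have "sgn (- sweep a n (b 0)) = sgn (sweep a n (b 0))"
    using assms(4) turn sweep_minus_axis[of n "b 0" a] by (metis order_refl)
  with nz[OF \<open>b 0 \<in> B\<close>] show False
    by (simp add: sgn_if split: if_splits)
qed

section \<open>Cones spanned by diameters\<close>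

text \<open>
  Put \<open>w = y - x\<close> and \<open>K = (d\<^sup>2 + w \<bullet> w) / 2\<close>. The distance bounds between the points translate
  into inequalities for inner products, which carry over to \<open>s\<close> and \<open>-t\<close> by linearity:
  \<open>s \<bullet> w\<close> and \<open>-t \<bullet> w\<close> lie strictly between \<open>0\<close> and \<open>K\<close>, the strictness at \<open>K\<close> being due to
  \<open>y \<noteq> p, p'\<close> and \<open>x \<noteq> q, q'\<close>, and \<open>s \<bullet> (-t) \<le> s \<bullet> w + (-t) \<bullet> w - K\<close>. Suppose \<open>s\<close> and \<open>t\<close> were
  parallel. By the signs, \<open>s\<close> and \<open>-t\<close> are positive multiples \<open>\<alpha> e\<close> and \<open>\<beta> e\<close> of a unit
  vector \<open>e\<close>. Put \<open>\<gamma> = e \<bullet> w\<close>. The bounds by \<open>K\<close> turn the last inequality into \<open>\<alpha> < \<gamma>\<close> and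
  \<open>\<beta> < \<gamma>\<close>, while \<open>\<gamma>\<^sup>2 \<le> w \<bullet> w \<le> K\<close> turns it into \<open>(\<gamma> - \<alpha>) * (\<gamma> - \<beta>) \<le> 0\<close>.
\<close>

lemma diameter_cones_transversal:
  fixes x y p p' q q' :: "real^3"
  assumes "x \<noteq> y" "y \<noteq> p" "y \<noteq> p'" "x \<noteq> q" "x \<noteq> q'"
    and S: "{x, y, p, p', q, q'} \<subseteq> S" "\<And>u v. u \<in> S \<Longrightarrow> v \<in> S \<Longrightarrow> dist u v \<le> d"
    and p: "dist x p = d" "dist x p' = d" and q: "dist y q = d" "dist y q' = d"
    and s: "s \<in> closed_segment (p - x) (p' - x)" and t: "t \<in> closed_segment (q - y) (q' - y)"
  shows "t \<times> s \<noteq> 0"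
proof
  assume par: "t \<times> s = 0"
  define w where "w = y - x"
  define K where "K = (d\<^sup>2 + w \<bullet> w) / 2"
  have sq: "(u - v) \<bullet> (u - v) \<le> d\<^sup>2" if "u \<in> S" "v \<in> S" for u v
    using S(2)[OF that] by (metis dist_norm dot_square_norm norm_ge_zero power_mono)
  have eq: "(u - v) \<bullet> (u - v) = d\<^sup>2" if "dist u v = d" for u v :: "real^3"
    using that by (metis dist_norm dot_square_norm)
  have w0: "0 < w \<bullet> w" and wK: "w \<bullet> w \<le> K"
    using \<open>x \<noteq> y\<close> sq[of y x] S(1) by (auto simp: w_def K_def)
  have half: "c \<bullet> w > 0 \<and> c \<bullet> w < K" if "c \<bullet> c = d\<^sup>2" "(c - w) \<bullet> (c - w) \<le> d\<^sup>2" "c \<noteq> w"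
    for c :: "real^3"
  proof -
    have "0 < (c - w) \<bullet> (c - w)"
      using that by simp
    with that show ?thesis
      using w0 by (simp add: K_def inner_diff inner_commute del: inner_gt_zero_iff)
  qed
  have P: "c \<bullet> w > 0 \<and> c \<bullet> w < K" if "c \<in> {p - x, p' - x}" for c
  proof (rule half)
    show "c \<bullet> c = d\<^sup>2"
      using that p eq[of p x] eq[of p' x] by (auto simp: dist_commute)
    show "(c - w) \<bullet> (c - w) \<le> d\<^sup>2"
      using that sq[of p y] sq[of p' y] S(1) by (auto simp: w_def algebra_simps)
    show "c \<noteq> w"
      using that assms(2,3) by (auto simp: w_def)
  qed
  have Q: "(- c) \<bullet> w > 0 \<and> (- c) \<bullet> w < K" if "c \<in> {q - y, q' - y}" for c
  proof (rule half)
    show "(- c) \<bullet> (- c) = d\<^sup>2"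
      using that q eq[of q y] eq[of q' y] by (auto simp: dist_commute)
    have "(- c - w) \<bullet> (- c - w) = (c + w) \<bullet> (c + w)"
      by (simp add: algebra_simps)
    then show "(- c - w) \<bullet> (- c - w) \<le> d\<^sup>2"
      using that sq[of q x] sq[of q' x] S(1) by (auto simp: w_def algebra_simps)
    show "- c \<noteq> w"
      using that assms(4,5) by (auto simp: w_def)
  qed
  have PQ: "c \<bullet> (- e) \<le> c \<bullet> w + (- e) \<bullet> w - K"
    if "c \<in> {p - x, p' - x}" "e \<in> {q - y, q' - y}" for c e
  proof -
    have "(c - e - w) \<bullet> (c - e - w) \<le> d\<^sup>2"
      using that sq[of p q] sq[of p q'] sq[of p' q] sq[of p' q'] S(1)
      by (auto simp: w_def algebra_simps)
    moreover have "c \<bullet> c = d\<^sup>2" "e \<bullet> e = d\<^sup>2"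
      using that eq p q by (auto simp: dist_commute)
    ultimately show ?thesis
      by (simp add: K_def inner_diff inner_add inner_commute field_simps)
  qed
  have between: "min (f u) (f v) \<le> f r \<and> f r \<le> max (f u) (f v)"
    if "r \<in> closed_segment u v" "linear f" for r u v and f :: "real^3 \<Rightarrow> real"
  proof -
    have "f r \<in> closed_segment (f u) (f v)"
      using closed_segment_linear_image[OF \<open>linear f\<close>, of u v] that(1) by blast
    then show ?thesis
      by (auto simp: closed_segment_eq_real_ivl split: if_splits)
  qed
  have lin: "linear (\<lambda>r::real^3. r \<bullet> v)" for v
    by (auto intro!: linearI simp: inner_simps)
  have s1: "s \<bullet> w > 0" "s \<bullet> w < K"
    using between[OF s lin[of w]] P[of "p - x"] P[of "p' - x"] by auto
  have t1: "(- t) \<bullet> w > 0" "(- t) \<bullet> w < K"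
    using between[OF t lin[of w]] Q[of "q - y"] Q[of "q' - y"]
    by (auto simp del: minus_diff_eq)
  have ct: "c \<bullet> (- t) \<le> c \<bullet> w + (- t) \<bullet> w - K" if "c \<in> {p - x, p' - x}" for c
  proof -
    have "t \<bullet> (w - c) \<le> c \<bullet> w - K"
    proof -
      have "(q - y) \<bullet> (w - c) \<le> c \<bullet> w - K" "(q' - y) \<bullet> (w - c) \<le> c \<bullet> w - K"
        using PQ[OF that, of "q - y"] PQ[OF that, of "q' - y"]
        by (simp_all add: inner_simps inner_commute)
      then show ?thesis
        using between[OF t lin[of "w - c"]] by linarith
    qed
    then show ?thesis
      by (simp add: inner_simps inner_commute)
  qed
  have "s \<bullet> (- t - w) \<le> (- t) \<bullet> w - K"
  proof -
    have "(p - x) \<bullet> (- t - w) \<le> (- t) \<bullet> w - K" "(p' - x) \<bullet> (- t - w) \<le> (- t) \<bullet> w - K"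
      using ct[of "p - x"] ct[of "p' - x"] by (simp_all add: inner_simps)
    then show ?thesis
      using between[OF s lin[of "- t - w"]] by linarith
  qed
  then have st: "s \<bullet> (- t) \<le> s \<bullet> w + (- t) \<bullet> w - K"
    by (simp add: inner_simps)
  obtain l where l: "- t = l *\<^sub>R s"
  proof -
    have "s \<times> t = 0"
      using par cross_skew[of s t] by simp
    moreover have "s \<noteq> 0" "t \<noteq> 0"
      using s1 t1 by auto
    ultimately obtain c where "t = c *\<^sub>R s"
      unfolding cross_eq_0 collinear_lemma by auto
    then show thesis
      using that[of "- c"] by simp
  qed
  have "0 < l"
    using t1 s1 l by (simp add: zero_less_mult_iff)
  \<comment> \<open>The argument above, without normalising: \<open>\<sigma> = \<alpha>\<^sup>2\<close>, \<open>c = \<alpha> * \<gamma>\<close> and \<open>l = \<beta> / \<alpha>\<close>.\<close>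
  define \<sigma> where "\<sigma> = s \<bullet> s"
  define c where "c = s \<bullet> w"
  have "0 < \<sigma>"
    using s1 by (auto simp: \<sigma>_def)
  have st': "l * \<sigma> \<le> c + l * c - K" "0 < c" "c < K" "l * c < K"
    using st s1 t1 unfolding l c_def \<sigma>_def by (auto simp: algebra_simps)
  have CS: "c\<^sup>2 \<le> \<sigma> * K"
  proof -
    have "c\<^sup>2 \<le> \<sigma> * (w \<bullet> w)"
      unfolding c_def \<sigma>_def by (rule Cauchy_Schwarz_ineq)
    also have "\<dots> \<le> \<sigma> * K"
      using wK \<open>0 < \<sigma>\<close> by (simp add: mult_left_mono)
    finally show ?thesis .
  qed
  have "l * \<sigma> < l * c"
    using st' by linarith
  then have a: "\<sigma> < c"
    using \<open>0 < l\<close> by simp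
  have b: "l * \<sigma> < c"
    using st' by linarith
  have "0 < (c - \<sigma>) * (c - l * \<sigma>)"
    using a b by simp
  moreover have "\<sigma> * (l * \<sigma>) \<le> \<sigma> * (c + l * c - K)"
    using st'(1) \<open>0 < \<sigma>\<close> by (simp add: mult_left_mono)
  ultimately show False
    using CS by (simp add: algebra_simps power2_eq_square)
qed

section \<open>Diameter graphs in three-dimensional space\<close>

definition diameter_pairs :: "'a::metric_space set \<Rightarrow> ('a \<times> 'a) set" where
  "diameter_pairs S = {(x, y). x \<in> S \<and> y \<in> S \<and> dist x y = diameter S}"

lemma sym_diameter_pairs: "sym (diameter_pairs S)"
  by (auto simp: sym_def diameter_pairs_def dist_commute)

text \<open>
  With alternating signs, the two edge vectors at the vertex \<open>f (Suc i)\<close> of a walk become, up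
  to a common sign, the vectors from this vertex to its two neighbours. So the path of
  edge vectors stays in the cones of \<open>diameter_cones_transversal\<close>, and it is the odd length that
  makes it end at the negative of its starting point.
\<close>

lemma odd_closed_walks_of_diameters_meet:
  fixes S :: "(real^3) set"
  assumes "bounded S"
    and n: "odd n" "closed_walk (diameter_pairs S) n c"
    and m: "odd m" "closed_walk (diameter_pairs S) m d"
  shows "range c \<inter> range d \<noteq> {}"
proof
  assume disj: "range c \<inter> range d = {}"
  define edge :: "(nat \<Rightarrow> real^3) \<Rightarrow> nat \<Rightarrow> real^3"
    where "edge f i = (- 1) ^ i *\<^sub>R (f (Suc i) - f i)" for f i
  have antipodal: "edge f l = - edge f 0" if "odd l" "closed_walk (diameter_pairs S) l f" for f l
  proof -
    have "f (0 + l) = f 0" "f (1 + l) = f 1"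
      using that(2) unfolding closed_walk_def by blast+
    then show ?thesis
      using that(1) by (simp add: edge_def)
  qed
  have in_cone: "(- 1) ^ Suc i *\<^sub>R s
      \<in> closed_segment (f i - f (Suc i)) (f (Suc (Suc i)) - f (Suc i))"
    if "s \<in> closed_segment (edge f i) (edge f (Suc i))" for f i s
  proof -
    let ?k = "(- 1) ^ Suc i :: real"
    have "linear (\<lambda>v::real^3. ?k *\<^sub>R v)"
      by (rule linear_scale_self)
    then have "?k *\<^sub>R s \<in> closed_segment (?k *\<^sub>R edge f i) (?k *\<^sub>R edge f (Suc i))"
      using that closed_segment_linear_image by blast
    then show ?thesis
      by (simp add: edge_def algebra_simps flip: power_mult_distrib)
  qed
  have "\<exists>i<n. \<exists>j<m. \<exists>s\<in>closed_segment (edge c i) (edge c (Suc i)).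
      \<exists>t\<in>closed_segment (edge d j) (edge d (Suc j)). t \<times> s = 0"
    using n m by (intro antipodal_polygons_meet antipodal) (auto intro: odd_pos)
  then obtain i j s t where
    s: "s \<in> closed_segment (edge c i) (edge c (Suc i))" and
    t: "t \<in> closed_segment (edge d j) (edge d (Suc j))" and "t \<times> s = 0"
    by blast
  have E: "(f i, f (Suc i)) \<in> diameter_pairs S"
    if "closed_walk (diameter_pairs S) l f" for f :: "nat \<Rightarrow> real^3" and i l
    using that by (simp add: closed_walk_def)
  have "((- 1) ^ Suc j *\<^sub>R t) \<times> ((- 1) ^ Suc i *\<^sub>R s) \<noteq> 0"
  proof (rule diameter_cones_transversal[where S = S and d = "diameter S"])
    show "{c (Suc i), d (Suc j), c i, c (Suc (Suc i)), d j, d (Suc (Suc j))} \<subseteq> S"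
      using E[OF n(2)] E[OF m(2)] by (auto simp: diameter_pairs_def)
    show "dist u v \<le> diameter S" if "u \<in> S" "v \<in> S" for u v
      using diameter_bounded_bound[OF \<open>bounded S\<close>] that by blast
    show "dist (c (Suc i)) (c i) = diameter S" "dist (c (Suc i)) (c (Suc (Suc i))) = diameter S"
      using E[OF n(2), of i] E[OF n(2), of "Suc i"] by (auto simp: diameter_pairs_def dist_commute)
    show "dist (d (Suc j)) (d j) = diameter S" "dist (d (Suc j)) (d (Suc (Suc j))) = diameter S"
      using E[OF m(2), of j] E[OF m(2), of "Suc j"] by (auto simp: diameter_pairs_def dist_commute)
  qed (use disj in_cone[OF s] in_cone[OF t] in blast)+
  with \<open>t \<times> s = 0\<close> show False
    by (simp only: cross_mult_left cross_mult_right) simp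
qed

lemma triangle_free_if_girth_gt_3:
  assumes "0 < diameter S" "3 < girth (diameter_graph S)"
  shows "(x, x) \<notin> diameter_pairs S ^^ 3"
proof
  assume "(x, x) \<in> diameter_pairs S ^^ 3"
  then obtain y z where "(x, y) \<in> diameter_pairs S" "(y, z) \<in> diameter_pairs S"
    "(z, x) \<in> diameter_pairs S"
    by (auto simp: numeral_3_eq_3)
  then have S: "{x, y, z} \<subseteq> S" and
    dist: "dist x y = diameter S" "dist y z = diameter S" "dist z x = diameter S"
    by (auto simp: diameter_pairs_def)
  then have distinct: "x \<noteq> y" "y \<noteq> z" "z \<noteq> x"
    using assms(1) by auto
  have "{x, y} \<in> snd (diameter_graph S)" "{y, z} \<in> snd (diameter_graph S)"
    "{z, x} \<in> snd (diameter_graph S)"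
    unfolding diameter_graph_def using S dist distinct by auto
  then have "is_cycle (diameter_graph S) [x, y, z]"
    using S distinct by (auto simp: is_cycle_def diameter_graph_def All_less_Suc)
  then have "girth (diameter_graph S) \<le> enat (length [x, y, z])"
    unfolding girth_def by (intro INF_lower) simp
  also have "length [x, y, z] = 3"
    by simp
  finally show False
    using assms(2) by (simp add: numeral_eq_enat)
qed

lemma smaller_diameter_if_independent:
  assumes "finite S" "0 < diameter S" "independent_in (diameter_pairs S) A" "A \<subseteq> S"
  shows "smaller_diameter A S"
proof (cases "A = {}")
  case True
  then show ?thesis
    using assms(2) by (simp add: smaller_diameter_def)
next
  case False
  have "finite A"
    using assms(1,4) finite_subset by blast
  then obtain x y where xy: "x \<in> A" "y \<in> A" "dist x y = diameter A"
    using diameter_compact_attained[OF finite_imp_compact False] by blast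
  have "diameter A \<le> diameter S"
    using assms(1,4) by (intro diameter_subset finite_imp_bounded)
  moreover have "diameter A \<noteq> diameter S"
    using assms(3) subsetD[OF assms(4)] xy unfolding independent_in_def diameter_pairs_def by auto
  ultimately show ?thesis
    using \<open>finite A\<close> by (simp add: smaller_diameter_def finite_imp_bounded)
qed

lemma borsuk_number_le_size:
  assumes "0 < k" "S \<noteq> {}" "kfold_cover k S F" "\<And>A. A \<in># F \<Longrightarrow> smaller_diameter A S"
  shows "borsuk_number k S \<le> size F"
proof -
  have "F \<noteq> {#}"
    using assms(1-3) by (auto simp: kfold_cover_def)
  then show ?thesis
    unfolding borsuk_number_def using assms by (intro Least_le) (auto simp: nonempty_has_size)
qed

text \<open>
  The members of the cover are intersected with \<open>S\<close>, since independence allows them to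
  contain arbitrary points outside \<open>S\<close>.
\<close>

theorem theorem5:
  fixes S :: "(real ^ 3) set"
  assumes "finite S"
    and "0 < diameter S"
    and "3 < girth (diameter_graph S)"
  shows "\<exists>k::nat. 0 < k \<and> borsuk_number k S < 4 * k"
proof -
  obtain k F where k: "0 < k" "size F < 4 * k" "\<And>x. k \<le> size {#A \<in># F. x \<in> A#}"
    and F: "\<And>A. A \<in># F \<Longrightarrow> independent_in (diameter_pairs S) A"
  proof (rule fractional_cover_if_odd_closed_walks_meet[OF sym_diameter_pairs[of S]])
    show "(x, x) \<notin> diameter_pairs S" for x
      using assms(2) by (auto simp: diameter_pairs_def)
    show "(x, x) \<notin> diameter_pairs S ^^ 3" for x
      using assms(2,3) by (rule triangle_free_if_girth_gt_3)
    show "range c \<inter> range d \<noteq> {}"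
      if "odd n" "odd m" "closed_walk (diameter_pairs S) n c" "closed_walk (diameter_pairs S) m d"
      for n m c d
      using odd_closed_walks_of_diameters_meet[OF finite_imp_bounded[OF assms(1)]] that by blast
  qed blast
  define F' where "F' = image_mset (\<lambda>A. A \<inter> S) F"
  have "size {#A \<in># F'. x \<in> A#} = size {#A \<in># F. x \<in> A#}" if "x \<in> S" for x
    using that by (simp add: F'_def filter_mset_image_mset)
  then have "kfold_cover k S F'"
    using k(3) by (simp add: kfold_cover_def)
  moreover have "smaller_diameter A S" if "A \<in># F'" for A
    using that F assms(1,2)
    by (auto simp: F'_def independent_in_def intro!: smaller_diameter_if_independent)
  moreover have "S \<noteq> {}"
    using assms(2) by auto
  ultimately have "borsuk_number k S \<le> size F'"
    using k(1) by (intro borsuk_number_le_size)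
  also have "\<dots> < 4 * k"
    using k(2) by (simp add: F'_def)
  finally show ?thesis
    using k(1) by blast
qed

end
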